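(* Let $\mathcal H$ be a complex Hilbert space, let $\mathcal Q\subseteq L(\mathcal H)$ be the set of (bounded, not necessarily orthogonal) projections, and let $T,T'\in\mathcal Q\mathcal Q$, with $T'$ of closed range. The following conditions are equivalent: 1. $T\overset{+}{\leq}T'$ (plus order); 2. for all $(E',F')\in[\mathcal Q\mathcal Q]_{T'}$ there exists $(E,F)\in[\mathcal Q\mathcal Q]_{T}$ such that $E\overset{-}{\leq}E'$ and $F\overset{-}{\leq}F'$ (minus order).
   Context: $L(\mathcal H)$ is the algebra of bounded linear operators on $\mathcal H$; $R(T)$ and $N(T)$ are the range and nullspace of $T$. $\mathcal Q=\{Q\in L(\mathcal H):Q^2=Q\}$, $\mathcal Q\mathcal Q=\{EF: E,F\in\mathcal Q\}$, and for $T\in\mathcal Q\mathcal Q$, $$[\mathcal Q\mathcal Q]_T=\{(E,F)\in\mathcal Q\times\mathcal Q: T=EF,\ R(E)=\overline{R(T)},\ N(F)=N(T)\}.$$ For $A,B\in L(\mathcal H)$: - $A\overset{-}{\leq}B$ (minus order) if there are $\tilde Q,Q\in\mathcal Q$ such that $A=\tilde QB=BQ$; - $A\overset{+}{\leq}B$ (plus order) if $R(A)\subseteq R(B)$, $R(A^* )\subseteq R(B^* )$ and there are $\tilde Q,Q\in\mathcal Q$ such that $A=\tilde QBQ$. *)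

theory Defs
  imports "HOL-Analysis.Analysis"
begin

class complex_vector = real_vector +
  fixes scaleC :: "complex \<Rightarrow> 'a \<Rightarrow> 'a" (infixr "*\<^sub>C" 75)
  assumes scaleC_add_right: "c *\<^sub>C (x + y) = c *\<^sub>C x + c *\<^sub>C y"
    and scaleC_add_left: "(c + d) *\<^sub>C x = c *\<^sub>C x + d *\<^sub>C x"
    and scaleC_scaleC: "c *\<^sub>C (d *\<^sub>C x) = (c * d) *\<^sub>C x"
    and scaleC_one: "1 *\<^sub>C x = x"
    and scaleR_scaleC: "r *\<^sub>R x = complex_of_real r *\<^sub>C x"

text \<open>
  The complex inner product is linear in the first argument. Its real part is the real inner
  product of the class \<^class>\<open>real_inner\<close>; since \<open>cinner x x\<close> is real by conjugate symmetry,
  this gives \<open>cinner x x = x \<bullet> x\<close>, hence positive definiteness, and makes the norm, metric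
  and topology those induced by \<open>cinner\<close>.
\<close>

class complex_inner = complex_vector + real_inner +
  fixes cinner :: "'a \<Rightarrow> 'a \<Rightarrow> complex"
  assumes cinner_commute: "cinner x y = cnj (cinner y x)"
    and cinner_add_left: "cinner (x + y) z = cinner x z + cinner y z"
    and cinner_scaleC_left: "cinner (c *\<^sub>C x) y = c * cinner x y"
    and Re_cinner: "Re (cinner x y) = x \<bullet> y"

class chilbert_space = complex_inner + complete_space

lemma cinner_self: "cinner x x = complex_of_real ((norm x)\<^sup>2)"
  for x :: "'h::complex_inner"
  using cinner_commute[of x x] Re_cinner[of x x]
  by (simp add: complex_eq_iff power2_norm_eq_inner)

instantiation complex :: chilbert_space
begin

definition scaleC_complex :: "complex \<Rightarrow> complex \<Rightarrow> complex" where
  "scaleC_complex c x = c * x"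

definition cinner_complex :: "complex \<Rightarrow> complex \<Rightarrow> complex" where
  "cinner_complex x y = x * cnj y"

instance
  by standard
    (auto simp: scaleC_complex_def cinner_complex_def inner_complex_def scaleR_conv_of_real
      algebra_simps)

end

definition bounded_clinear :: "('h::chilbert_space \<Rightarrow> 'h) \<Rightarrow> bool" where
  "bounded_clinear A \<longleftrightarrow> bounded_linear A \<and> (\<forall>c x. A (c *\<^sub>C x) = c *\<^sub>C A x)"

text \<open>The adjoint exists and is unique for bounded complex-linear \<open>A\<close> by the Riesz theorem;
  for other functions the value is unspecified.\<close>

definition cadjoint :: "('h::chilbert_space \<Rightarrow> 'h) \<Rightarrow> ('h \<Rightarrow> 'h)" where
  "cadjoint A = (THE B. bounded_clinear B \<and> (\<forall>x y. cinner (A x) y = cinner x (B y)))"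

definition nullspace :: "('h::chilbert_space \<Rightarrow> 'h) \<Rightarrow> 'h set" where
  "nullspace A = {x. A x = 0}"

definition projections :: "('h::chilbert_space \<Rightarrow> 'h) set" where
  "projections = {Q. bounded_clinear Q \<and> Q \<circ> Q = Q}"

definition projection_products :: "('h::chilbert_space \<Rightarrow> 'h) set" where
  "projection_products = {E \<circ> F | E F. E \<in> projections \<and> F \<in> projections}"

definition factorizations ::
    "('h::chilbert_space \<Rightarrow> 'h) \<Rightarrow> (('h \<Rightarrow> 'h) \<times> ('h \<Rightarrow> 'h)) set" where
  "factorizations T = {(E, F). E \<in> projections \<and> F \<in> projections \<and> T = E \<circ> F \<and>
     range E = closure (range T) \<and> nullspace F = nullspace T}"

definition minus_le :: "('h::chilbert_space \<Rightarrow> 'h) \<Rightarrow> ('h \<Rightarrow> 'h) \<Rightarrow> bool"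
    (infix "\<le>\<^sup>-" 50) where
  "A \<le>\<^sup>- B \<longleftrightarrow> (\<exists>Q'\<in>projections. \<exists>Q\<in>projections. A = Q' \<circ> B \<and> A = B \<circ> Q)"

definition plus_le :: "('h::chilbert_space \<Rightarrow> 'h) \<Rightarrow> ('h \<Rightarrow> 'h) \<Rightarrow> bool"
    (infix "\<le>\<^sup>+" 50) where
  "A \<le>\<^sup>+ B \<longleftrightarrow> range A \<subseteq> range B \<and> range (cadjoint A) \<subseteq> range (cadjoint B) \<and>
     (\<exists>Q'\<in>projections. \<exists>Q\<in>projections. A = Q' \<circ> B \<circ> Q)"

end

theory Submission
  imports Defs
begin

text \<open>
  For projections, \<open>E \<le>\<^sup>- E'\<close> means \<open>R(E) \<subseteq> R(E')\<close> and \<open>N(E') \<subseteq> N(E)\<close>. If \<open>T \<le>\<^sup>+ T'\<close>, the projections in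
  \<open>T = Q' T' Q\<close> can be compressed by orthogonal projections so that \<open>R(Q')\<close> is the closure of \<open>R(T)\<close>
  and \<open>N(Q) = N(T)\<close>; then \<open>E = Q' E'\<close> and \<open>F = F' Q\<close> form the required factorization. Conversely,
  \<open>T = E F = E (E' F') F\<close>, and \<open>N(T') = N(F') \<subseteq> N(F) = N(T)\<close> gives the inclusion of the ranges of
  the adjoints, because \<open>T'\<close> has closed range and hence the range of its adjoint is the orthogonal
  complement of \<open>N(T')\<close>. The latter is the closed range theorem, obtained here from uniform
  boundedness; the same compression applied to any \<open>T' = E F\<close> shows that \<open>T'\<close> has a factorization
  of the required kind.
\<close>

section \<open>Nearest points and uniform boundedness in real Hilbert spaces\<close>

lemma nearest_point_orthogonal:
  fixes M :: "'h::{real_inner,complete_space} set"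
  assumes "subspace M" "closed M"
  obtains p where "p \<in> M" "\<And>y. y \<in> M \<Longrightarrow> (x - p) \<bullet> y = 0"
proof -
  define \<delta> where "\<delta> = (INF y\<in>M. (norm (x - y))\<^sup>2)"
  \<comment> \<open>Near-minimizers of the distance to \<open>x\<close>: nested nonempty closed sets
    whose diameters tend to zero, so completeness leaves exactly one common point.\<close>
  define S where "S n = {y \<in> M. (norm (x - y))\<^sup>2 \<le> \<delta> + inverse (real (Suc n))}" for n
  have ne: "M \<noteq> {}"
    using assms(1) subspace_0 by blast
  have lower: "\<delta> \<le> (norm (x - y))\<^sup>2" if "y \<in> M" for y
    unfolding \<delta>_def by (rule cINF_lower[OF _ that]) (auto intro: bdd_belowI2[of _ 0])
  have "closed (S n)" for n
  proof -
    have "S n = M \<inter> {y. (norm (x - y))\<^sup>2 \<le> \<delta> + inverse (real (Suc n))}"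
      by (auto simp: S_def)
    then show ?thesis
      using assms(2) by (auto intro!: closed_Collect_le continuous_intros)
  qed
  moreover have "S n \<noteq> {}" for n
  proof -
    have "\<exists>y\<in>M. (norm (x - y))\<^sup>2 < \<delta> + inverse (real (Suc n))"
      unfolding \<delta>_def
      by (rule cInf_lessD[of "(\<lambda>y. (norm (x - y))\<^sup>2) ` M", simplified bex_simps]) (use ne in auto)
    then show ?thesis
      by (auto simp: S_def intro: less_imp_le)
  qed
  moreover have "S n \<subseteq> S m" if "m \<le> n" for m n
  proof -
    have "inverse (real (Suc n)) \<le> inverse (real (Suc m))"
      using that by (intro le_imp_inverse_le) auto
    then have "\<delta> + inverse (real (Suc n)) \<le> \<delta> + inverse (real (Suc m))"
      by simp
    then show ?thesis
      unfolding S_def using order_trans by blast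
  qed
  moreover have "\<exists>n. \<forall>y\<in>S n. \<forall>z\<in>S n. dist y z < e" if "0 < e" for e
  proof -
    have "0 < e\<^sup>2 / 4" using that by simp
    then obtain n where n: "inverse (real (Suc n)) < e\<^sup>2 / 4"
      using reals_Archimedean by blast
    have "dist y z < e" if "y \<in> S n" "z \<in> S n" for y z
    proof -
      have mid: "(1/2) *\<^sub>R (y + z) \<in> M"
        using that assms(1) by (auto simp: S_def intro: subspace_scale subspace_add)
      \<comment> \<open>Parallelogram law for \<open>x - y\<close> and \<open>x - z\<close>. The
        midpoint lies in \<open>M\<close>, so the subtracted term is at least four times the
        infimum.\<close>
      have "(norm (y - z))\<^sup>2 = 2 * (norm (x - y))\<^sup>2 + 2 * (norm (x - z))\<^sup>2
          - 4 * (norm (x - (1/2) *\<^sub>R (y + z)))\<^sup>2"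
        by (simp add: power2_norm_eq_inner inner_diff_left inner_diff_right inner_add_left
            inner_add_right inner_commute algebra_simps)
      also have "\<dots> \<le> 4 * inverse (real (Suc n))"
        using that lower[OF mid] by (simp add: S_def del: of_nat_Suc)
      also have "\<dots> < e\<^sup>2" using n by simp
      finally show ?thesis
        using \<open>0 < e\<close> by (metis dist_norm less_imp_le power2_less_imp_less)
    qed
    then show ?thesis by blast
  qed
  ultimately obtain p where p: "(\<Inter>n. S n) = {p}"
    using decreasing_closed_nest_sing[of S] by (metis (full_types) full_SetCompr_eq)
  then have pS: "p \<in> S n" for n by blast
  then have pM: "p \<in> M" by (auto simp: S_def)
  have "(norm (x - p))\<^sup>2 \<le> \<delta> + e" if "0 < e" for e
  proof -
    obtain n where "inverse (real (Suc n)) < e"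
      using reals_Archimedean \<open>0 < e\<close> by blast
    moreover have "(norm (x - p))\<^sup>2 \<le> \<delta> + inverse (real (Suc n))"
      using pS[of n] by (simp add: S_def)
    ultimately show ?thesis by linarith
  qed
  then have min: "(norm (x - p))\<^sup>2 \<le> \<delta>"
    by (rule field_le_epsilon)
  have "(x - p) \<bullet> y = 0" if y: "y \<in> M" for y
  proof (cases "y = 0")
    case False
    \<comment> \<open>The minimizer over \<open>t\<close> of the squared distance from
      \<open>x\<close> to \<open>p + t y\<close>: moving from \<open>p\<close> to that point would
      lower the distance unless the inner product vanishes.\<close>
    define t where "t = ((x - p) \<bullet> y) / (y \<bullet> y)"
    have yy: "0 < y \<bullet> y" using False by simp
    have "p + t *\<^sub>R y \<in> M"
      using pM y assms(1) by (auto intro: subspace_scale subspace_add)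
    then have "(norm (x - p))\<^sup>2 \<le> (norm (x - (p + t *\<^sub>R y)))\<^sup>2"
      using lower min order_trans by blast
    also have "\<dots> = (norm (x - p))\<^sup>2 - 2 * t * ((x - p) \<bullet> y) + t * t * (y \<bullet> y)"
      by (simp add: power2_norm_eq_inner inner_diff_left inner_diff_right inner_add_left
            inner_add_right inner_commute algebra_simps)
    also have "t * t * (y \<bullet> y) = t * ((x - p) \<bullet> y)"
      using yy by (simp add: t_def)
    finally have "t * ((x - p) \<bullet> y) \<le> 0" by simp
    then have "((x - p) \<bullet> y)\<^sup>2 \<le> 0"
      using yy by (simp add: t_def power2_eq_square divide_le_0_iff)
    then show ?thesis by simp
  qed simp
  with pM that show ?thesis by blast
qed

text \<open>Uniform boundedness for the functionals given by inner products with elements of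
  \<open>Y\<close>. The closed sets \<open>S n\<close> cover the space, so by Baire one of them
  contains a ball, and a common bound on a ball bounds the norms.\<close>

lemma pointwise_bounded_imp_bounded:
  fixes Y :: "'h::{real_inner,complete_space} set"
  assumes "\<And>x. \<exists>c. \<forall>y\<in>Y. \<bar>x \<bullet> y\<bar> \<le> c"
  shows "bounded Y"
proof -
  define S where "S n = {x. \<forall>y\<in>Y. \<bar>x \<bullet> y\<bar> \<le> real n}" for n
  have "x \<in> \<Union>(range S)" for x
  proof -
    obtain c where "\<forall>y\<in>Y. \<bar>x \<bullet> y\<bar> \<le> c" using assms by blast
    moreover obtain n where "c \<le> real n" using real_arch_simple by blast
    ultimately have "x \<in> S n" unfolding S_def using order_trans by blast
    then show ?thesis by blast
  qed
  then have "\<Union>(range S) = UNIV" by blast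
  then have "interior (\<Union>(range S)) \<noteq> {}" by simp
  moreover have "closed (S n)" for n
  proof -
    have "S n = (\<Inter>y\<in>Y. {x. \<bar>x \<bullet> y\<bar> \<le> real n})" by (auto simp: S_def)
    then show ?thesis by (auto intro!: closed_INT closed_Collect_le continuous_intros)
  qed
  ultimately obtain n where "interior (S n) \<noteq> {}"
    using Baire_category_alt[of "euclidean :: 'h topology" "range S"]
      completely_metrizable_space_euclidean
    by (auto simp: image_iff)
  then obtain a r where r: "0 < r" "cball a r \<subseteq> S n"
    by (metis all_not_in_conv mem_interior_cball)
  have "norm y \<le> 2 * real n / r" if "y \<in> Y" for y
  proof (cases "y = 0")
    case False
    \<comment> \<open>A vector of length \<open>r\<close> along \<open>y\<close>; subtracting the
      bounds at \<open>a\<close> and \<open>a + h\<close> removes the centre of the ball.\<close>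
    define h where "h = (r / norm y) *\<^sub>R y"
    have "a \<in> S n" "a + h \<in> S n"
      using r False by (auto simp: h_def dist_norm subset_iff)
    then have "\<bar>a \<bullet> y\<bar> \<le> real n" "\<bar>(a + h) \<bullet> y\<bar> \<le> real n"
      using that by (auto simp: S_def)
    moreover have "h \<bullet> y = r * norm y"
      using False by (simp add: h_def flip: power2_norm_eq_inner) (simp add: power2_eq_square)
    ultimately have "r * norm y \<le> 2 * real n"
      by (simp add: inner_add_left)
    then show ?thesis using r by (simp add: field_simps)
  qed (use r in simp)
  then show ?thesis by (auto simp: bounded_iff)
qed

section \<open>Complex inner products\<close>

lemma cinner_add_right: "cinner x (y + z) = cinner x y + cinner x z"
  by (metis cinner_add_left cinner_commute complex_cnj_add)

lemma cinner_scaleC_right: "cinner x (c *\<^sub>C y) = cnj c * cinner x y"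
  by (metis cinner_commute cinner_scaleC_left complex_cnj_mult)

lemma cinner_zero_left [simp]: "cinner 0 x = 0"
  by (metis add_cancel_left_left add.right_neutral cinner_add_left)

lemma cinner_zero_right [simp]: "cinner x 0 = 0"
  by (metis cinner_commute cinner_zero_left complex_cnj_zero)

lemma cinner_diff_left: "cinner (x - y) z = cinner x z - cinner y z"
  by (metis add_diff_cancel_right' cinner_add_left diff_add_cancel)

lemma cinner_diff_right: "cinner x (y - z) = cinner x y - cinner x z"
  by (metis add_diff_cancel_right' cinner_add_right diff_add_cancel)

lemma cinner_eq_0_iff: "cinner x x = 0 \<longleftrightarrow> x = 0"
  by (simp add: cinner_self)

lemma cinner_ext: "(\<And>z. cinner z x = cinner z y) \<Longrightarrow> x = y"
  by (metis cinner_diff_right cinner_eq_0_iff eq_iff_diff_eq_0)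

lemma scaleC_zero_right [simp]: "c *\<^sub>C (0 :: 'a::complex_vector) = 0"
  using scaleC_add_right[of c 0 "0 :: 'a"] by simp

lemma norm_scaleC: "norm (c *\<^sub>C x) = cmod c * norm (x :: 'h::complex_inner)"
proof -
  have "complex_of_real ((norm (c *\<^sub>C x))\<^sup>2) = c * cnj c * complex_of_real ((norm x)\<^sup>2)"
    by (simp only: cinner_self[symmetric] cinner_scaleC_left cinner_scaleC_right mult_ac)
  also have "\<dots> = complex_of_real ((cmod c * norm x)\<^sup>2)"
    by (simp add: power_mult_distrib flip: complex_norm_square)
  finally show ?thesis
    by (simp only: of_real_eq_iff) (simp add: power2_eq_iff_nonneg)
qed

lemma norm_cinner_le: "cmod (cinner x y) \<le> norm x * norm y"
proof (cases "cinner x y = 0")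
  case False
  \<comment> \<open>A unimodular factor that turns \<open>cinner x y\<close> into its modulus, so
    that the real Cauchy-Schwarz inequality applies.\<close>
  define c where "c = cnj (cinner x y) / cmod (cinner x y)"
  have "cinner (c *\<^sub>C x) y = complex_of_real (cmod (cinner x y))"
    using False complex_norm_square[of "cinner x y"]
    by (simp add: cinner_scaleC_left c_def field_simps power2_eq_square)
  then have "cmod (cinner x y) = (c *\<^sub>C x) \<bullet> y"
    by (metis Re_cinner Re_complex_of_real)
  also have "\<dots> \<le> norm (c *\<^sub>C x) * norm y"
    by (rule norm_cauchy_schwarz)
  also have "norm (c *\<^sub>C x) = norm x"
    using False by (simp add: norm_scaleC c_def norm_divide)
  finally show ?thesis .
qed simp

lemma bounded_linear_scaleC: "bounded_linear (\<lambda>x::'h::complex_inner. c *\<^sub>C x)"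
  by (rule bounded_linear_intro[of _ "cmod c"])
    (simp_all add: scaleC_add_right scaleR_scaleC scaleC_scaleC norm_scaleC mult.commute)

lemma cinner_scaleR_left: "cinner (r *\<^sub>R x) y = complex_of_real r * cinner x y"
  by (simp add: scaleR_scaleC cinner_scaleC_left)

lemma bounded_linear_cinner_left: "bounded_linear (\<lambda>x. cinner x y)"
  by (rule bounded_linear_intro[of _ "norm y"])
    (simp_all add: cinner_add_left cinner_scaleR_left norm_cinner_le scaleR_conv_of_real)

section \<open>Complex subspaces, ranges and nullspaces\<close>

definition csubspace :: "'h::complex_vector set \<Rightarrow> bool" where
  "csubspace M \<longleftrightarrow> subspace M \<and> (\<forall>c. \<forall>x\<in>M. c *\<^sub>C x \<in> M)"

lemma csubspace_closure:
  fixes M :: "'h::complex_inner set"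
  assumes "csubspace M"
  shows "csubspace (closure M)"
proof -
  have "c *\<^sub>C x \<in> closure M" if "x \<in> closure M" for c x
    using that closure_bounded_linear_image_subset[OF bounded_linear_scaleC, of c M] assms
      closure_mono[of "(\<lambda>x. c *\<^sub>C x) ` M" M]
    by (auto simp: csubspace_def)
  moreover have "x + y \<in> closure M" if "x \<in> closure M" "y \<in> closure M" for x y
  proof -
    obtain u v where "\<And>n. u n \<in> M" "u \<longlonglongrightarrow> x" "\<And>n. v n \<in> M" "v \<longlonglongrightarrow> y"
      using \<open>x \<in> closure M\<close> \<open>y \<in> closure M\<close> by (auto simp: closure_sequential)
    then have "(\<lambda>n. u n + v n) \<longlonglongrightarrow> x + y" "\<And>n. u n + v n \<in> M"
      using assms by (auto simp: csubspace_def subspace_add intro: tendsto_add)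
    then show ?thesis
      by (metis (no_types, lifting) closure_sequential)
  qed
  moreover have "0 \<in> closure M"
    using assms closure_subset[of M] by (auto simp: csubspace_def subspace_0)
  ultimately show ?thesis
    by (simp add: csubspace_def subspace_def scaleR_scaleC)
qed

lemma csubspace_range:
  assumes "bounded_clinear A"
  shows "csubspace (range A)"
proof -
  have "subspace (range A)"
    using assms subspace_UNIV by (simp add: bounded_clinear_def bounded_linear.linear linear_subspace_image)
  moreover have "c *\<^sub>C A x \<in> range A" for c x
    using assms by (metis bounded_clinear_def rangeI)
  ultimately show ?thesis by (auto simp: csubspace_def)
qed

lemma kernel_closed:
  assumes "bounded_linear f"
  shows "closed {x. f x = 0}"
  using assms by (intro closed_Collect_eq linear_continuous_on continuous_on_const)

text \<open>Homogeneity is asked only at zeros of \<open>f\<close>, so that both complex functionals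
  and operators on the space are covered.\<close>

lemma kernel_csubspace:
  assumes "bounded_linear f" "\<And>c x. f x = 0 \<Longrightarrow> f (c *\<^sub>C x) = 0"
  shows "csubspace {x. f x = 0}"
  using assms(2) linear_subspace_kernel[OF bounded_linear.linear[OF assms(1)]]
  by (auto simp: csubspace_def)

lemma closed_nullspace: "bounded_clinear A \<Longrightarrow> closed (nullspace A)"
  unfolding nullspace_def bounded_clinear_def by (blast intro: kernel_closed)

lemma csubspace_nullspace:
  assumes "bounded_clinear A"
  shows "csubspace (nullspace A)"
proof -
  have "A (c *\<^sub>C x) = 0" if "A x = 0" for c x
    using assms that by (simp add: bounded_clinear_def)
  then show ?thesis
    using assms kernel_csubspace[of A] by (simp add: nullspace_def bounded_clinear_def)
qed

section \<open>Orthogonal projections, Riesz representation and adjoints\<close>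

lemma nearest_point_corthogonal:
  fixes M :: "'h::chilbert_space set"
  assumes "csubspace M" "closed M"
  obtains p where "p \<in> M" "\<And>y. y \<in> M \<Longrightarrow> cinner (x - p) y = 0"
proof -
  obtain p where p: "p \<in> M" "\<And>y. y \<in> M \<Longrightarrow> (x - p) \<bullet> y = 0"
    using nearest_point_orthogonal[of M x] assms by (metis csubspace_def)
  have "cinner (x - p) y = 0" if "y \<in> M" for y
  proof -
    \<comment> \<open>The real part of the inner product with \<open>i y\<close> is the imaginary
      part of the one with \<open>y\<close>.\<close>
    have "\<i> *\<^sub>C y \<in> M" using that assms by (simp add: csubspace_def)
    then have "Re (cinner (x - p) (\<i> *\<^sub>C y)) = 0" "Re (cinner (x - p) y) = 0"
      using p that by (simp_all add: Re_cinner)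
    then show ?thesis by (simp add: cinner_scaleC_right complex_eq_iff)
  qed
  with p that show ?thesis by blast
qed

theorem orthogonal_projection_exists:
  fixes M :: "'h::chilbert_space set"
  assumes "csubspace M" "closed M"
  obtains P where "P \<in> projections" "range P = M" "\<And>x y. y \<in> M \<Longrightarrow> cinner (x - P x) y = 0"
proof -
  have "\<exists>p\<in>M. \<forall>y\<in>M. cinner (x - p) y = 0" for x
    by (rule nearest_point_corthogonal[OF assms, of x]) blast
  then obtain P where PM: "\<And>x. P x \<in> M" and orth: "\<And>x y. y \<in> M \<Longrightarrow> cinner (x - P x) y = 0"
    by metis
  have sub: "subspace M" using assms by (simp add: csubspace_def)
  \<comment> \<open>Orthogonality of the residual determines the point of \<open>M\<close>;
    additivity and homogeneity of \<open>P\<close> then follow by checking the candidate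
    values.\<close>
  have uniq: "P x = p" if "p \<in> M" "\<And>y. y \<in> M \<Longrightarrow> cinner (x - p) y = 0" for x p
  proof -
    have "P x - p \<in> M" using PM that sub by (simp add: subspace_diff)
    then have "cinner (x - p) (P x - p) - cinner (x - P x) (P x - p) = 0"
      using that orth by simp
    then have "cinner (P x - p) (P x - p) = 0"
      by (simp flip: cinner_diff_left)
    then show ?thesis by (simp add: cinner_eq_0_iff)
  qed
  have id: "P x = x" if "x \<in> M" for x
    using that by (intro uniq) auto
  have add: "P (x + y) = P x + P y" for x y
  proof (rule uniq)
    show "P x + P y \<in> M" using PM sub by (simp add: subspace_add)
    show "cinner (x + y - (P x + P y)) z = 0" if "z \<in> M" for z
      using orth[OF that, of x] orth[OF that, of y]
      by (simp add: cinner_diff_left cinner_add_left)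
  qed
  have scale: "P (c *\<^sub>C x) = c *\<^sub>C P x" for c x
  proof (rule uniq)
    show "c *\<^sub>C P x \<in> M" using PM assms by (simp add: csubspace_def)
    show "cinner (c *\<^sub>C x - c *\<^sub>C P x) y = 0" if "y \<in> M" for y
      using orth[OF that] by (simp add: cinner_diff_left cinner_scaleC_left)
  qed
  have "norm (P x) \<le> norm x * 1" for x
  proof -
    have "(x - P x) \<bullet> P x = 0"
      using orth[OF PM] by (simp flip: Re_cinner)
    then have "norm (P x) * norm (P x) = x \<bullet> P x"
      by (simp add: inner_diff_left power2_norm_eq_inner flip: power2_eq_square)
    also have "\<dots> \<le> norm x * norm (P x)" by (rule norm_cauchy_schwarz)
    finally show ?thesis
      by (cases "norm (P x) = 0") auto
  qed
  then have "bounded_linear P"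
    using add scale by (intro bounded_linear_intro[of _ 1]) (auto simp: scaleR_scaleC)
  then have "P \<in> projections"
    using scale id PM by (auto simp: projections_def bounded_clinear_def)
  moreover have "range P = M"
    using PM id by (metis image_subsetI rangeI subsetI subset_antisym)
  ultimately show ?thesis using orth that by blast
qed

theorem riesz_representation:
  fixes f :: "'h::chilbert_space \<Rightarrow> complex"
  assumes "bounded_linear f" "\<And>c x. f (c *\<^sub>C x) = c * f x"
  obtains v where "\<And>x. f x = cinner x v"
proof (cases "\<forall>x. f x = 0")
  case True
  then show ?thesis using that[of 0] by simp
next
  case False
  then obtain z where z: "f z \<noteq> 0" by blast
  interpret f: bounded_linear f by (rule assms)
  let ?K = "{x. f x = 0}"
  have "csubspace ?K" "closed ?K"
    using assms by (auto intro!: kernel_csubspace kernel_closed)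
  then obtain p where p: "p \<in> ?K" "\<And>y. y \<in> ?K \<Longrightarrow> cinner (z - p) y = 0"
    by (rule nearest_point_corthogonal[of ?K z]) blast
  \<comment> \<open>Orthogonal to the kernel of \<open>f\<close> but not in it: every
    \<open>x\<close> is a multiple of \<open>w\<close> plus a kernel element.\<close>
  define w where "w = z - p"
  have fw: "f w \<noteq> 0" using z p(1) by (simp add: w_def f.diff)
  then have ww: "cinner w w \<noteq> 0" by (auto simp: cinner_eq_0_iff)
  \<comment> \<open>The factor is chosen so that both sides agree at \<open>x = w\<close>; its
    conjugates come from antilinearity in the second argument.\<close>
  have "f x = cinner x ((cnj (f w) / cnj (cinner w w)) *\<^sub>C w)" for x
  proof -
    have "f (x - (f x / f w) *\<^sub>C w) = 0"
      using fw by (simp add: f.diff assms(2))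
    then have "cinner w (x - (f x / f w) *\<^sub>C w) = 0"
      using p(2) by (simp add: w_def)
    then have "cinner (x - (f x / f w) *\<^sub>C w) w = 0"
      by (metis cinner_commute complex_cnj_zero)
    then have "cinner x w = f x / f w * cinner w w"
      by (simp add: cinner_diff_left cinner_scaleC_left)
    then show ?thesis
      using fw ww by (simp add: cinner_scaleC_right)
  qed
  then show ?thesis by (rule that)
qed

text \<open>For each fixed \<open>y\<close>, Riesz represents the functional sending
  \<open>x\<close> to \<open>cinner (A x) y\<close>; linearity of \<open>B\<close> comes from
  uniqueness of the representing vectors.\<close>

lemma cadjoint_exists:
  fixes A :: "'h::chilbert_space \<Rightarrow> 'h"
  assumes A: "bounded_clinear A"
  shows "\<exists>B. bounded_clinear B \<and> (\<forall>x y. cinner (A x) y = cinner x (B y))"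
proof -
  have lin: "bounded_linear A" and sc: "\<And>c x. A (c *\<^sub>C x) = c *\<^sub>C A x"
    using A by (auto simp: bounded_clinear_def)
  have "\<exists>v. \<forall>x. cinner (A x) y = cinner x v" for y
    by (rule riesz_representation[of "\<lambda>x. cinner (A x) y"])
      (auto intro: bounded_linear_compose[OF bounded_linear_cinner_left lin]
        simp: sc cinner_scaleC_left)
  then obtain B where B: "\<And>x y. cinner (A x) y = cinner x (B y)" by metis
  have add: "B (x + y) = B x + B y" for x y
    by (rule cinner_ext) (simp add: cinner_add_right flip: B)
  have scale: "B (c *\<^sub>C x) = c *\<^sub>C B x" for c x
    by (rule cinner_ext) (simp add: cinner_scaleC_right flip: B)
  obtain K where K: "\<And>x. norm (A x) \<le> norm x * K"
    using bounded_linear.bounded[OF lin] by blast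
  have "norm (B y) \<le> norm y * K" for y
  proof -
    \<comment> \<open>Setting \<open>x = B y\<close> in the adjoint identity transfers the bound
      \<open>K\<close> from \<open>A\<close> to \<open>B\<close>.\<close>
    have "norm (B y) * norm (B y) = A (B y) \<bullet> y"
      using B[of "B y" y] by (simp add: power2_norm_eq_inner flip: Re_cinner power2_eq_square)
    also have "\<dots> \<le> norm (A (B y)) * norm y" by (rule norm_cauchy_schwarz)
    also have "\<dots> \<le> norm (B y) * K * norm y" by (intro mult_right_mono K) simp
    finally have "norm (B y) * norm (B y) \<le> norm (B y) * (norm y * K)" by (simp add: ac_simps)
    moreover have "0 \<le> norm y * K"
      using K[of y] norm_ge_zero order_trans by blast
    ultimately show ?thesis
      by (cases "norm (B y) = 0") auto
  qed
  then have "bounded_linear B"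
    using add scale by (intro bounded_linear_intro[of _ K]) (auto simp: scaleR_scaleC)
  with B scale show ?thesis by (auto simp: bounded_clinear_def)
qed

text \<open>Existence and uniqueness make the description in \<open>cadjoint\<close> denote an
  operator; everything later about adjoints rests on these two facts.\<close>

lemma
  assumes "bounded_clinear A"
  shows bounded_clinear_cadjoint: "bounded_clinear (cadjoint A)"
    and cinner_cadjoint: "cinner (A x) y = cinner x (cadjoint A y)"
proof -
  have "\<exists>!B. bounded_clinear B \<and> (\<forall>x y. cinner (A x) y = cinner x (B y))"
    by (rule ex_ex1I[OF cadjoint_exists[OF assms]]) (metis cinner_ext ext)
  from theI'[OF this, folded cadjoint_def]
  show "bounded_clinear (cadjoint A)" "cinner (A x) y = cinner x (cadjoint A y)"
    by simp_all
qed

section \<open>Ranges and nullspaces of adjoints\<close>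

lemma nullspace_iff_orthogonal:
  assumes "bounded_clinear A"
  shows "x \<in> nullspace A \<longleftrightarrow> (\<forall>y. cinner x (cadjoint A y) = 0)"
proof
  assume "\<forall>y. cinner x (cadjoint A y) = 0"
  \<comment> \<open>The hypothesis is tested at \<open>y = A x\<close>.\<close>
  then have "cinner (A x) (A x) = 0" by (simp add: cinner_cadjoint[OF assms])
  then show "x \<in> nullspace A" by (simp add: cinner_eq_0_iff nullspace_def)
qed (simp add: nullspace_def flip: cinner_cadjoint[OF assms])

text \<open>The adjoint is bounded below on the complete space \<open>range A\<close>, so the image
  of that space is complete; this image is the whole range of the adjoint, since the adjoint kills
  the orthogonal complement of \<open>range A\<close>.\<close>

lemma closed_range_cadjoint:
  fixes A :: "'h::chilbert_space \<Rightarrow> 'h"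
  assumes A: "bounded_clinear A" and closed: "closed (range A)"
  shows "closed (range (cadjoint A))"
proof -
  let ?K = "range A" and ?B = "cadjoint A"
  have B: "bounded_linear ?B" and Bs: "\<And>c x. ?B (c *\<^sub>C x) = c *\<^sub>C ?B x"
    using bounded_clinear_cadjoint[OF A] by (auto simp: bounded_clinear_def)
  interpret B: bounded_linear ?B by (rule B)
  obtain P where P: "range P = ?K" "\<And>x y. y \<in> ?K \<Longrightarrow> cinner (x - P x) y = 0"
    by (rule orthogonal_projection_exists[OF csubspace_range[OF A] closed]) blast
  have B_P: "?B (P y) = ?B y" for y
  proof (rule cinner_ext)
    fix z
    have "cinner (A z) (y - P y) = 0"
      using P(2)[of "A z" y] by (metis cinner_commute complex_cnj_zero rangeI)
    then show "cinner z (?B (P y)) = cinner z (?B y)"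
      by (simp add: cinner_diff_right flip: cinner_cadjoint[OF A])
  qed
  \<comment> \<open>Boundedness of \<open>Y\<close> is the lower bound in disguise. It holds because
    \<open>P x = A z\<close> turns the inner product of \<open>x\<close> and \<open>y\<close> into
    that of \<open>z\<close> and \<open>cadjoint A y\<close>.\<close>
  define Y where "Y = {y \<in> ?K. norm (?B y) \<le> 1}"
  have "\<exists>c. \<forall>y\<in>Y. \<bar>x \<bullet> y\<bar> \<le> c" for x
  proof -
    obtain z where z: "P x = A z" using P(1) by (metis imageE rangeI)
    have "\<bar>x \<bullet> y\<bar> \<le> norm z" if "y \<in> Y" for y
    proof -
      have "cinner x y = cinner (A z) y"
        using P(2)[of y x] that by (simp add: Y_def cinner_diff_left flip: z)
      then have "x \<bullet> y = z \<bullet> ?B y"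
        by (metis Re_cinner cinner_cadjoint[OF A])
      also have "\<bar>\<dots>\<bar> \<le> norm z * norm (?B y)" by (rule Cauchy_Schwarz_ineq2)
      also have "\<dots> \<le> norm z * 1" using that by (intro mult_left_mono) (auto simp: Y_def)
      finally show ?thesis by simp
    qed
    then show ?thesis by blast
  qed
  then have "bounded Y" by (rule pointwise_bounded_imp_bounded)
  then obtain C where C: "0 < C" "\<And>y. y \<in> Y \<Longrightarrow> norm y \<le> C"
    by (auto simp: bounded_pos)
  have sub: "subspace ?K" using csubspace_range[OF A] by (simp add: csubspace_def)
  have below: "norm y / C \<le> norm (?B y)" if "y \<in> ?K" for y
  proof (cases "?B y = 0")
    case True
    \<comment> \<open>Normalization by \<open>norm (?B y)\<close> is impossible here, but
      \<open>y = A z\<close> is orthogonal to itself once the adjoint kills it.\<close>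
    have "cinner y y = 0"
    proof -
      obtain z where "y = A z" using \<open>y \<in> ?K\<close> by blast
      then show ?thesis using True by (simp add: cinner_cadjoint[OF A])
    qed
    then show ?thesis by (simp add: cinner_eq_0_iff)
  next
    case False
    have "(1 / norm (?B y)) *\<^sub>R y \<in> Y"
      using that False sub by (auto simp: Y_def subspace_scale B.scaleR simp del: image_iff)
    then have "norm ((1 / norm (?B y)) *\<^sub>R y) \<le> C" by (rule C(2))
    then show ?thesis using False C(1) by (simp add: field_simps)
  qed
  have "complete (?B ` ?K)"
    by (rule complete_isometric_image[of "1 / C"])
      (use C sub below closed B in \<open>auto simp: complete_eq_closed\<close>)
  moreover have "range ?B = ?B ` ?K"
    using B_P P(1) by (metis image_comp image_cong comp_apply)
  ultimately show ?thesis by (simp add: complete_eq_closed)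
qed

text \<open>For the converse direction, the residual \<open>x - p\<close> of the nearest point in
  the closed range of the adjoint lies in \<open>nullspace A\<close>; it is orthogonal to both
  \<open>x\<close> and \<open>p\<close>, hence zero.\<close>

lemma range_cadjoint_iff_orthogonal:
  fixes A :: "'h::chilbert_space \<Rightarrow> 'h"
  assumes A: "bounded_clinear A" and closed: "closed (range A)"
  shows "x \<in> range (cadjoint A) \<longleftrightarrow> (\<forall>y\<in>nullspace A. cinner x y = 0)"
proof
  assume "x \<in> range (cadjoint A)"
  then obtain z where "x = cadjoint A z" by blast
  then have "cinner y x = 0" if "y \<in> nullspace A" for y
    using that nullspace_iff_orthogonal[OF A] by blast
  then show "\<forall>y\<in>nullspace A. cinner x y = 0"
    by (metis cinner_commute complex_cnj_zero)
next
  assume x: "\<forall>y\<in>nullspace A. cinner x y = 0"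
  obtain p where p: "p \<in> range (cadjoint A)"
    "\<And>y. y \<in> range (cadjoint A) \<Longrightarrow> cinner (x - p) y = 0"
    using nearest_point_corthogonal csubspace_range[OF bounded_clinear_cadjoint[OF A]]
      closed_range_cadjoint[OF assms] by metis
  then have "x - p \<in> nullspace A"
    by (simp add: nullspace_iff_orthogonal[OF A])
  then have "cinner x (x - p) = 0" using x by blast
  then have "cinner (x - p) x = 0" by (metis cinner_commute complex_cnj_zero)
  then have "cinner (x - p) (x - p) = 0"
    using p by (simp add: cinner_diff_right)
  then show "x \<in> range (cadjoint A)"
    using p(1) by (simp add: cinner_eq_0_iff)
qed

lemma range_cadjoint_orthogonal:
  fixes A :: "'h::chilbert_space \<Rightarrow> 'h"
  assumes A: "bounded_clinear A"
  shows "y \<in> nullspace A \<Longrightarrow> cinner (cadjoint A x) y = 0"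
  using nullspace_iff_orthogonal[OF A] by (metis cinner_commute complex_cnj_zero)

text \<open>The nullspace is the orthogonal complement of the range of the adjoint, and complements
  reverse inclusions.\<close>

lemma nullspace_antimono_cadjoint:
  fixes A B :: "'h::chilbert_space \<Rightarrow> 'h"
  assumes "bounded_clinear A" "bounded_clinear B"
    and "range (cadjoint A) \<subseteq> range (cadjoint B)"
  shows "nullspace B \<subseteq> nullspace A"
proof
  fix x
  assume x: "x \<in> nullspace B"
  have "cinner x (cadjoint A y) = 0" for y
  proof -
    obtain z where "cadjoint A y = cadjoint B z" using assms(3) by blast
    then show ?thesis using x nullspace_iff_orthogonal[OF assms(2)] by simp
  qed
  then show "x \<in> nullspace A" by (simp add: nullspace_iff_orthogonal[OF assms(1)])
qed

text \<open>The range of \<open>cadjoint A\<close> is orthogonal to \<open>nullspace A\<close>,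
  hence to \<open>nullspace B\<close>; closedness of \<open>range B\<close> puts all such vectors
  into the range of \<open>cadjoint B\<close>. In the application \<open>A\<close> is
  \<open>T\<close>, whose range may fail to be closed.\<close>

lemma range_cadjoint_mono:
  fixes A B :: "'h::chilbert_space \<Rightarrow> 'h"
  assumes "bounded_clinear A" "bounded_clinear B" "closed (range B)"
    and "nullspace B \<subseteq> nullspace A"
  shows "range (cadjoint A) \<subseteq> range (cadjoint B)"
proof (rule image_subsetI)
  fix x
  show "cadjoint A x \<in> range (cadjoint B)"
    unfolding range_cadjoint_iff_orthogonal[OF assms(2,3)]
    using assms(4) range_cadjoint_orthogonal[OF assms(1)] by blast
qed

section \<open>Projections and the minus order\<close>

lemma bounded_clinear_comp:
  "bounded_clinear A \<Longrightarrow> bounded_clinear B \<Longrightarrow> bounded_clinear (A \<circ> B)"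
  by (simp add: bounded_clinear_def o_def bounded_linear_compose)

lemma projections_bounded_clinear: "Q \<in> projections \<Longrightarrow> bounded_clinear Q"
  by (simp add: projections_def)

lemma projection_idem: "Q \<in> projections \<Longrightarrow> Q (Q x) = Q x"
  by (metis (mono_tags, lifting) comp_apply mem_Collect_eq projections_def)

lemma projection_range_iff: "Q \<in> projections \<Longrightarrow> x \<in> range Q \<longleftrightarrow> Q x = x"
  by (metis imageE projection_idem rangeI)

lemma projection_zero: "Q \<in> projections \<Longrightarrow> Q 0 = 0"
  by (metis bounded_clinear_def bounded_linear.linear linear_0 projections_bounded_clinear)

lemma projection_diff: "Q \<in> projections \<Longrightarrow> Q (x - y) = Q x - Q y"
  by (metis bounded_clinear_def bounded_linear.linear linear_diff projections_bounded_clinear)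

lemma projectionsI:
  "bounded_clinear Q \<Longrightarrow> (\<And>x. Q (Q x) = Q x) \<Longrightarrow> Q \<in> projections"
  by (auto simp: projections_def)

lemma projections_compI:
  assumes "P \<in> projections" "Q \<in> projections" "\<And>x. P (Q (P (Q x))) = P (Q x)"
  shows "P \<circ> Q \<in> projections"
  using assms by (intro projectionsI)
    (simp_all add: bounded_clinear_comp projections_bounded_clinear)

lemma projection_compl:
  assumes "Q \<in> projections"
  shows "(\<lambda>x. x - Q x) \<in> projections"
proof (rule projectionsI)
  have "bounded_linear Q" "\<And>c x. Q (c *\<^sub>C x) = c *\<^sub>C Q x"
    using assms by (auto simp: projections_def bounded_clinear_def)
  moreover have "c *\<^sub>C (x - y) = c *\<^sub>C x - c *\<^sub>C y" for c and x y :: 'a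
    by (metis add_diff_cancel_right' diff_add_cancel scaleC_add_right)
  ultimately show "bounded_clinear (\<lambda>x. x - Q x)"
    by (simp add: bounded_clinear_def bounded_linear_sub bounded_linear_ident)
qed (simp add: projection_diff projection_idem assms)

text \<open>The difference \<open>x - P x\<close> lies in \<open>nullspace P\<close>, so
  \<open>Q\<close> kills it.\<close>

lemma projection_kernel_comp:
  assumes "P \<in> projections" "Q \<in> projections" "nullspace P \<subseteq> nullspace Q"
  shows "Q (P x) = Q x"
proof -
  have "x - P x \<in> nullspace P"
    using assms by (simp add: nullspace_def projection_diff projection_idem)
  then have "Q (x - P x) = 0"
    using assms(3) by (auto simp: nullspace_def)
  then show ?thesis by (simp add: projection_diff assms(2))
qed

lemma minus_le_projections_iff:
  assumes "E \<in> projections" "E' \<in> projections"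
  shows "E \<le>\<^sup>- E' \<longleftrightarrow> range E \<subseteq> range E' \<and> nullspace E' \<subseteq> nullspace E"
proof
  assume "E \<le>\<^sup>- E'"
  then obtain Q Q' where Q: "Q' \<in> projections" "E = Q' \<circ> E'" "E = E' \<circ> Q"
    by (auto simp: minus_le_def)
  have "range E \<subseteq> range E'" by (subst Q(3)) auto
  moreover have "nullspace E' \<subseteq> nullspace E"
    by (subst Q(2)) (auto simp: nullspace_def projection_zero[OF Q(1)])
  ultimately show "range E \<subseteq> range E' \<and> nullspace E' \<subseteq> nullspace E" ..
next
  assume *: "range E \<subseteq> range E' \<and> nullspace E' \<subseteq> nullspace E"
  then have "E' (E x) = E x" for x
    using projection_range_iff[OF assms(2)] by blast
  then have "E = E' \<circ> E" by (simp add: fun_eq_iff)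
  moreover have "E = E \<circ> E'"
    using projection_kernel_comp[OF assms(2,1)] * by (simp add: fun_eq_iff)
  \<comment> \<open>Both witnesses are \<open>E\<close> itself.\<close>
  ultimately show "E \<le>\<^sup>- E'"
    using assms(1) by (auto simp: minus_le_def)
qed

section \<open>Compression of projections and factorizations\<close>

text \<open>With \<open>P\<close> the orthogonal projection onto \<open>M\<close>, the choice is
  \<open>P\<close> after \<open>Q\<close>: \<open>Q\<close> fixes \<open>M\<close>, so
  \<open>Q P = P\<close> and the product is idempotent.\<close>

lemma projection_shrink_range:
  assumes Q: "Q \<in> projections" and M: "csubspace M" "closed M" "M \<subseteq> range Q"
  obtains R where "R \<in> projections" "range R = M"
    "\<And>x. Q x \<in> M \<Longrightarrow> R x = Q x"
proof -
  obtain P where P: "P \<in> projections" "range P = M"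
    by (rule orthogonal_projection_exists[OF M(1,2)]) blast
  have QP: "Q (P x) = P x" for x
    using P(2) M(3) projection_range_iff[OF Q] by blast
  have id: "P (Q x) = x" if "x \<in> M" for x
  proof -
    have "Q x = x" using that M(3) projection_range_iff[OF Q] by blast
    moreover have "P x = x" using that P(2) projection_range_iff[OF P(1)] by blast
    ultimately show ?thesis by simp
  qed
  show ?thesis
  proof (rule that[of "P \<circ> Q"])
    show "P \<circ> Q \<in> projections"
      using P Q by (intro projections_compI)
        (auto simp: QP projection_idem)
    show "range (P \<circ> Q) = M"
      using P(2) id by (auto simp: image_iff) (metis)
    show "(P \<circ> Q) x = Q x" if "Q x \<in> M" for x
      using that P projection_range_iff[OF P(1)] by auto
  qed
qed

text \<open>Dual to shrinking the range: with \<open>G\<close> the complement of the orthogonal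
  projection onto \<open>N\<close>, the choice is \<open>Q\<close> after \<open>G\<close>,
  idempotent because \<open>G Q = G\<close>. The last conclusion controls the error, so that an
  operator vanishing on \<open>Q N\<close> cannot see the change.\<close>

lemma projection_enlarge_nullspace:
  assumes Q: "Q \<in> projections" and N: "csubspace N" "closed N" "nullspace Q \<subseteq> N"
  obtains R where "R \<in> projections" "nullspace R = N" "range R \<subseteq> range Q"
    "\<And>x. Q x - R x \<in> Q ` N"
proof -
  obtain P where P: "P \<in> projections" "range P = N"
    by (rule orthogonal_projection_exists[OF N(1,2)]) blast
  define G where "G x = x - P x" for x
  have G: "G \<in> projections"
    unfolding G_def by (rule projection_compl[OF P(1)])
  have N_G: "nullspace G = N"
    using P projection_range_iff[OF P(1)]
    by (auto simp: nullspace_def G_def projection_idem[OF P(1)])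
  have GQ: "G (Q x) = G x" for x
    using projection_kernel_comp[OF Q G] N N_G by simp
  have GG: "G (G x) = G x" for x by (rule projection_idem[OF G])
  show ?thesis
  proof (rule that[of "Q \<circ> G"])
    show "Q \<circ> G \<in> projections"
      using G Q by (intro projections_compI)
        (auto simp: GQ GG)
    \<comment> \<open>Here \<open>G x = G (G x) = G (Q (G x)) = G 0\<close>.\<close>
    have "G x = 0" if "Q (G x) = 0" for x
      using that GQ GG projection_zero[OF G] by metis
    then show "nullspace (Q \<circ> G) = N"
      by (auto simp: nullspace_def projection_zero[OF Q] simp flip: N_G)
    show "range (Q \<circ> G) \<subseteq> range Q" by auto
    show "Q x - (Q \<circ> G) x \<in> Q ` N" for x
      using P(2) by (auto simp: G_def projection_diff[OF Q])
  qed
qed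

text \<open>The range is shrunk on the left and the nullspace enlarged on the right without changing
  the product. The middle factor is \<open>T'\<close> for the plus order and the identity for
  factorizations.\<close>

lemma projection_product_compress:
  fixes B :: "'h::chilbert_space \<Rightarrow> 'h"
  assumes Q: "Q' \<in> projections" "Q \<in> projections"
    and B: "bounded_clinear B" and T: "T = Q' \<circ> B \<circ> Q"
  obtains R' R where "R' \<in> projections" "R \<in> projections" "T = R' \<circ> B \<circ> R"
    "range R' = closure (range T)" "nullspace R = nullspace T"
proof -
  have bT: "bounded_clinear T"
    unfolding T by (intro bounded_clinear_comp projections_bounded_clinear Q B)
  have "closed (range Q')"
  proof -
    have "range Q' = nullspace (\<lambda>x. x - Q' x)"
      using projection_range_iff[OF Q(1)] by (auto simp: nullspace_def projection_idem[OF Q(1)])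
    then show ?thesis
      using closed_nullspace[OF projections_bounded_clinear[OF projection_compl[OF Q(1)]]] by simp
  qed
  then have ran: "closure (range T) \<subseteq> range Q'"
    by (intro closure_minimal) (auto simp: T)
  obtain R' where R': "R' \<in> projections" "range R' = closure (range T)"
    "\<And>x. Q' x \<in> closure (range T) \<Longrightarrow> R' x = Q' x"
    by (rule projection_shrink_range[OF Q(1) csubspace_closure[OF csubspace_range[OF bT]]
          closed_closure ran]) blast
  have B0: "B 0 = 0"
    using B by (metis bounded_clinear_def bounded_linear.linear linear_0)
  have nul: "nullspace Q \<subseteq> nullspace T"
    by (auto simp: nullspace_def T B0 projection_zero[OF Q(1)])
  obtain R where R: "R \<in> projections" "nullspace R = nullspace T"
    "\<And>x. Q x - R x \<in> Q ` nullspace T" "range R \<subseteq> range Q"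
    by (rule projection_enlarge_nullspace[OF Q(2) csubspace_nullspace[OF bT]
          closed_nullspace[OF bT] nul]) blast
  \<comment> \<open>The error \<open>Q x - R x\<close> is \<open>Q n\<close> with
    \<open>T n = 0\<close>, and \<open>T Q = T\<close>.\<close>
  have T_R: "T (R x) = T x" for x
  proof -
    obtain n where n: "n \<in> nullspace T" "Q x - R x = Q n" using R(3) by blast
    have TQ: "T (Q y) = T y" for y
      by (simp add: T projection_idem[OF Q(2)])
    have "T (Q x - R x) = 0"
      using n TQ by (simp add: nullspace_def)
    moreover have "T (Q x - R x) = T (Q x) - T (R x)"
      using bT by (metis bounded_clinear_def bounded_linear.linear linear_diff)
    ultimately show ?thesis using TQ by simp
  qed
  have "T x = R' (B (R x))" for x
  proof -
    have "Q (R x) = R x"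
      using R(4) projection_range_iff[OF Q(2)] by blast
    then have "T x = Q' (B (R x))"
      using T_R[of x] by (simp add: T)
    \<comment> \<open>The value of \<open>Q'\<close> here is \<open>T x\<close>, which lies in the
      closure of the range of \<open>T\<close>, so \<open>R'\<close> agrees with \<open>Q'\<close>
      at this point.\<close>
    moreover have "R' (B (R x)) = Q' (B (R x))"
      by (rule R'(3)) (metis calculation closure_subset rangeI subsetD)
    ultimately show ?thesis by simp
  qed
  then have "T = R' \<circ> B \<circ> R" by (simp add: fun_eq_iff)
  with R' R that show ?thesis by blast
qed

text \<open>Prevents the universally quantified condition on the factorizations of \<open>T'\<close>
  from being vacuous.\<close>

lemma factorizations_nonempty:
  assumes "T \<in> projection_products"
  shows "factorizations T \<noteq> {}"
proof -
  obtain E F where EF: "E \<in> projections" "F \<in> projections" "T = E \<circ> F"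
    using assms by (auto simp: projection_products_def)
  have "bounded_clinear (id :: 'a \<Rightarrow> 'a)"
    by (simp add: bounded_clinear_def id_def bounded_linear_ident)
  then obtain E' F' where "E' \<in> projections" "F' \<in> projections" "T = E' \<circ> id \<circ> F'"
    "range E' = closure (range T)" "nullspace F' = nullspace T"
    using projection_product_compress[OF EF(1,2), of id T] EF(3) by auto
  then have "(E', F') \<in> factorizations T" by (auto simp: factorizations_def)
  then show ?thesis by blast
qed

lemma projection_products_bounded_clinear:
  "T \<in> projection_products \<Longrightarrow> bounded_clinear T"
  unfolding projection_products_def using bounded_clinear_comp projections_bounded_clinear by blast

section \<open>The plus order and the minus order of the factors\<close>

theorem proposition6p5:
  fixes T T' :: "'h::chilbert_space \<Rightarrow> 'h"
  assumes "T \<in> projection_products"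
    and "T' \<in> projection_products"
    and "closed (range T')"
  shows "T \<le>\<^sup>+ T' \<longleftrightarrow>
    (\<forall>(E', F')\<in>factorizations T'. \<exists>(E, F)\<in>factorizations T. E \<le>\<^sup>- E' \<and> F \<le>\<^sup>- F')"
proof -
  have bT: "bounded_clinear T" and bT': "bounded_clinear T'"
    by (simp_all add: projection_products_bounded_clinear assms)
  show ?thesis
  proof
    assume le: "T \<le>\<^sup>+ T'"
    then obtain R' R where R: "R' \<in> projections" "R \<in> projections" "T = R' \<circ> T' \<circ> R"
      by (auto simp: plus_le_def)
    obtain Q' Q where Q: "Q' \<in> projections" "Q \<in> projections" "T = Q' \<circ> T' \<circ> Q"
      "range Q' = closure (range T)" "nullspace Q = nullspace T"
      by (rule projection_product_compress[OF R(1,2) bT' R(3)]) blast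
    have ran: "closure (range T) \<subseteq> range T'"
      using le assms(3) unfolding plus_le_def by (intro closure_minimal) auto
    \<comment> \<open>From here on, the inclusion of adjoint ranges acts only through this inclusion
      of nullspaces.\<close>
    have nul: "nullspace T' \<subseteq> nullspace T"
      using nullspace_antimono_cadjoint[OF bT bT'] le by (simp add: plus_le_def)
    have "\<exists>(E, F)\<in>factorizations T. E \<le>\<^sup>- E' \<and> F \<le>\<^sup>- F'"
      if "(E', F') \<in> factorizations T'" for E' F'
    proof -
      have EF': "E' \<in> projections" "F' \<in> projections" "T' = E' \<circ> F'"
        "range E' = range T'" "nullspace F' = nullspace T'"
        using that assms(3) by (auto simp: factorizations_def)
      \<comment> \<open>The range of \<open>Q'\<close> lies in that of \<open>E'\<close>, and the
        nullspace of \<open>F'\<close> in that of \<open>Q\<close>. Hence \<open>E' Q' = Q'\<close>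
        and \<open>Q F' = Q\<close>, which make \<open>Q' E'\<close> and \<open>F' Q\<close>
        idempotent, while \<open>E F = Q' T' Q = T\<close>.\<close>
      define E where "E = Q' \<circ> E'"
      define F where "F = F' \<circ> Q"
      have E'Q': "E' (Q' x) = Q' x" for x
        using ran Q(4) EF'(4) projection_range_iff[OF EF'(1)] by blast
      have QF': "Q (F' x) = Q x" for x
        using projection_kernel_comp[OF EF'(2) Q(2)] nul EF'(5) Q(5) by simp
      have E: "E \<in> projections" unfolding E_def
        using EF'(1) Q(1) by (intro projections_compI)
          (auto simp: E'Q' projection_idem)
      have F: "F \<in> projections" unfolding F_def
        using EF'(2) Q(2) by (intro projections_compI)
          (auto simp: QF' projection_idem)
      have "Q' x = E (Q' x)" for x
        by (simp add: E_def E'Q' projection_idem[OF Q(1)])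
      then have rE: "range E = closure (range T)"
        unfolding Q(4)[symmetric] by (auto simp: E_def)
      have "Q x = 0" if "F' (Q x) = 0" for x
        using that QF' projection_idem[OF Q(2)] projection_zero[OF Q(2)] by metis
      then have nF: "nullspace F = nullspace T"
        unfolding Q(5)[symmetric] by (auto simp: F_def nullspace_def projection_zero[OF EF'(2)])
      have "T = E \<circ> F"
        by (simp add: E_def F_def Q(3) EF'(3) o_assoc)
      then have "(E, F) \<in> factorizations T"
        using E F rE nF by (simp add: factorizations_def)
      moreover have "E \<le>\<^sup>- E'"
        unfolding minus_le_projections_iff[OF E EF'(1)]
        using rE ran EF'(4) by (auto simp: E_def nullspace_def projection_zero[OF Q(1)])
      moreover have "F \<le>\<^sup>- F'"
        unfolding minus_le_projections_iff[OF F EF'(2)]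
        using nF nul EF'(5) by (auto simp: F_def)
      ultimately show ?thesis by blast
    qed
    then show "\<forall>(E', F')\<in>factorizations T'. \<exists>(E, F)\<in>factorizations T. E \<le>\<^sup>- E' \<and> F \<le>\<^sup>- F'"
      by blast
  next
    assume R: "\<forall>(E', F')\<in>factorizations T'. \<exists>(E, F)\<in>factorizations T. E \<le>\<^sup>- E' \<and> F \<le>\<^sup>- F'"
    obtain E' F' where "(E', F') \<in> factorizations T'"
      using factorizations_nonempty[OF assms(2)] by auto
    moreover obtain E F where "(E, F) \<in> factorizations T" and le: "E \<le>\<^sup>- E'" "F \<le>\<^sup>- F'"
      using R calculation by blast
    ultimately have EF': "E' \<in> projections" "F' \<in> projections" "T' = E' \<circ> F'"
        "range E' = range T'" "nullspace F' = nullspace T'"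
      and EF: "E \<in> projections" "F \<in> projections" "T = E \<circ> F"
        "range E = closure (range T)" "nullspace F = nullspace T"
      using assms(3) by (auto simp: factorizations_def)
    have E_le: "range E \<subseteq> range E'" "nullspace E' \<subseteq> nullspace E"
      using le minus_le_projections_iff[OF EF(1) EF'(1)] by auto
    have F_le: "range F \<subseteq> range F'" "nullspace F' \<subseteq> nullspace F"
      using le minus_le_projections_iff[OF EF(2) EF'(2)] by auto
    have "E (E' x) = E x" for x
      by (rule projection_kernel_comp[OF EF'(1) EF(1) E_le(2)])
    moreover have "F' (F x) = F x" for x
      using F_le(1) projection_range_iff[OF EF'(2)] by blast
    \<comment> \<open>Absorption gives \<open>E F = (E E') (F' F)\<close>, so \<open>E\<close> and
      \<open>F\<close> are themselves the projections required by the plus order.\<close>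
    ultimately have "T = E \<circ> T' \<circ> F"
      by (simp add: fun_eq_iff EF(3) EF'(3))
    moreover have "range T \<subseteq> range T'"
      using E_le(1) EF(3) EF'(4) by auto
    moreover have "range (cadjoint T) \<subseteq> range (cadjoint T')"
      using range_cadjoint_mono[OF bT bT' assms(3)] F_le(2) EF(5) EF'(5) by simp
    ultimately show "T \<le>\<^sup>+ T'"
      using EF(1,2) by (auto simp: plus_le_def)
  qed
qed

end
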